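(* Let $d>0$ be a square-free integer. Then $\mathbb{Z}[\sqrt{-d}]$ does not satisfy property (princ), except for $\mathbb{Z}[\sqrt{-1}]$ and $\mathbb{Z}[\sqrt{-2}]$, which are principal ideal domains, and $\mathbb{Z}[\sqrt{-3}]$ and $\mathbb{Z}[\sqrt{-7}]$. That is, $\mathbb{Z}[\sqrt{-d}]$ satisfies property (princ) if and only if $d\in\{1,2,3,7\}$, and for $d\in\{1,2\}$ it is a principal ideal domain.
   Context: Two elements $a,b$ of an integral domain $R$ form an idempotent pair if either $a(1-a)\in bR$ or $b(1-b)\in aR$. $R$ satisfies property (princ) if every ideal of $R$ generated by an idempotent pair is principal. *)

theory Defs
  imports
    Complex_Main
    "HOL-Computational_Algebra.Squarefree"
    "HOL-Algebra.Ring_Divisibility"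
    "HOL-Algebra.Generated_Rings"
    "HOL-Algebra.Algebraic_Closure_Type"
begin

text \<open>In the next two definitions \<open>R\<close> is meant to be an integral domain; \<open>PIdl b\<close> is
  the set \<open>bR\<close> and \<open>Idl {a, b}\<close> is the ideal generated by \<open>a\<close> and \<open>b\<close>.\<close>

definition idempotent_pair :: "('a, 'm) ring_scheme \<Rightarrow> 'a \<Rightarrow> 'a \<Rightarrow> bool" where
  "idempotent_pair R a b \<longleftrightarrow>
     a \<in> carrier R \<and> b \<in> carrier R \<and>
     (a \<otimes>\<^bsub>R\<^esub> (\<one>\<^bsub>R\<^esub> \<ominus>\<^bsub>R\<^esub> a) \<in> PIdl\<^bsub>R\<^esub> b \<or> b \<otimes>\<^bsub>R\<^esub> (\<one>\<^bsub>R\<^esub> \<ominus>\<^bsub>R\<^esub> b) \<in> PIdl\<^bsub>R\<^esub> a)"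

definition princ :: "('a, 'm) ring_scheme \<Rightarrow> bool" where
  "princ R \<longleftrightarrow> (\<forall>a b. idempotent_pair R a b \<longrightarrow> principalideal (Idl\<^bsub>R\<^esub> {a, b}) R)"

text \<open>The ring \<open>\<int>[\<surd>(-d)]\<close> as a subring of the complex numbers. It is the order generated by
  \<open>\<surd>(-d)\<close>, not in general the full ring of integers of \<open>\<rat>(\<surd>(-d))\<close>.\<close>

definition Z_sqrt_neg :: "int \<Rightarrow> complex ring" where
  "Z_sqrt_neg d = ring_of_type_algebra
     \<lparr>carrier := {of_int x + of_int y * csqrt (- of_int d) | x y. True}\<rparr>"

lemma field_complex_ring: "field (ring_of_type_algebra :: complex ring)"
  by (rule field_from_type_algebra)

lemma subring_Z_sqrt_neg:
  "subring {of_int x + of_int y * csqrt (- of_int d) | x y. True}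
     (ring_of_type_algebra :: complex ring)" (is "subring ?S ?C")
proof -
  interpret C: field ?C by (rule field_complex_ring)
  have neg: "\<ominus>\<^bsub>?C\<^esub> z = - z" for z
    by (rule C.minus_equality) (simp_all add: ring_of_type_algebra_def)
  show ?thesis
  proof (rule C.subringI)
    show "?S \<subseteq> carrier ?C" by (simp add: ring_of_type_algebra_def)
    have "1 = of_int 1 + of_int 0 * csqrt (- of_int d)" by simp
    then have "1 \<in> ?S" by blast
    then show "\<one>\<^bsub>?C\<^esub> \<in> ?S" by (simp add: ring_of_type_algebra_def)
  next
    fix h assume "h \<in> ?S"
    then obtain x y where "h = of_int x + of_int y * csqrt (- of_int d)" by auto
    then have "- h = of_int (- x) + of_int (- y) * csqrt (- of_int d)" by simp
    then show "\<ominus>\<^bsub>?C\<^esub> h \<in> ?S" unfolding neg by blast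
  next
    fix h1 h2 assume "h1 \<in> ?S" "h2 \<in> ?S"
    then obtain x y u v where h: "h1 = of_int x + of_int y * csqrt (- of_int d)"
      "h2 = of_int u + of_int v * csqrt (- of_int d)" by auto
    have sq: "csqrt (- of_int d) * csqrt (- of_int d) = - of_int d"
      by (metis power2_csqrt power2_eq_square)
    have "h1 * h2 = of_int x * of_int u
        + of_int y * of_int v * (csqrt (- of_int d) * csqrt (- of_int d))
        + (of_int x * of_int v + of_int y * of_int u) * csqrt (- of_int d)"
      unfolding h by (simp add: algebra_simps)
    also have "\<dots> = of_int (x * u - d * y * v) + of_int (x * v + y * u) * csqrt (- of_int d)"
      unfolding sq by (simp add: algebra_simps)
    finally have "h1 * h2 = of_int (x * u - d * y * v) + of_int (x * v + y * u) * csqrt (- of_int d)" .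
    then have "h1 * h2 \<in> ?S" by blast
    then show "h1 \<otimes>\<^bsub>?C\<^esub> h2 \<in> ?S" by (simp add: ring_of_type_algebra_def)
    have "h1 + h2 = of_int (x + u) + of_int (y + v) * csqrt (- of_int d)"
      unfolding h by (simp add: algebra_simps)
    then have "h1 + h2 \<in> ?S" by blast
    then show "h1 \<oplus>\<^bsub>?C\<^esub> h2 \<in> ?S" by (simp add: ring_of_type_algebra_def)
  qed
qed

lemma domain_Z_sqrt_neg: "domain (Z_sqrt_neg d)"
proof -
  interpret C: field "ring_of_type_algebra :: complex ring" by (rule field_complex_ring)
  show ?thesis unfolding Z_sqrt_neg_def
    by (rule C.subring_is_domain[OF subring_Z_sqrt_neg])
qed

end

theory Submission
  imports Defs
begin

text \<open>Write \<open>w = \<surd>(-d)\<close>. If \<open>m > 1\<close> is odd, coprime to \<open>d\<close>, and divides \<open>s\<^sup>2 + d\<close>, choose \<open>y\<close> with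
  \<open>2sy \<equiv> 1\<close> modulo \<open>m\<close>; then \<open>a = y(s + w)\<close> is idempotent modulo \<open>m\<close>, and \<open>(a, m) = (s + w, m)\<close>
  has norm \<open>m\<close>. It is not principal if \<open>m < 2d\<close> and \<open>m\<close> is not of the form \<open>u\<^sup>2 + dv\<^sup>2\<close> with
  \<open>v \<noteq> 0\<close>, which is automatic for \<open>m < d\<close>. Such \<open>m\<close> and \<open>s\<close> exist for all \<open>d \<notin> {1, 2, 3, 7}\<close>:
  \<^item> \<open>d\<close> even: \<open>s = 2\<close>, \<open>m = d/2 + 2\<close>;
  \<^item> \<open>d\<close> odd and \<open>d + 1\<close> not a power of two: \<open>s = 1\<close>, \<open>m\<close> the odd part of \<open>d + 1\<close>;
  \<^item> \<open>d = 2^k - 1\<close> with \<open>k \<ge> 5\<close> odd: \<open>s = 3\<close>, \<open>m = (d + 9)/8\<close>;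
  \<^item> \<open>d = 15\<close>: \<open>s = 6\<close>, \<open>m = 17\<close>;
  \<^item> \<open>d = 2^k - 1\<close> with \<open>k \<ge> 6\<close> even: \<open>s = 7\<close>, \<open>m = (d + 49)/16\<close>. Here \<open>7\<close> does not divide \<open>m\<close>,
    since otherwise \<open>6\<close> divides \<open>k\<close> and \<open>63\<close> divides the square-free number \<open>d\<close>.

  Conversely, for \<open>d \<in> {1, 2, 3, 7}\<close> divide an ideal by a nonzero element of least norm. The
  resulting lattice contains \<open>1\<close> and no nonzero element of norm less than \<open>1\<close>, which forces it to
  be \<open>\<int>[w]\<close> or, for \<open>d \<in> {3, 7}\<close> only, \<open>\<int>[(1 + w)/2]\<close>. The second case does not arise from an
  idempotent pair because an idempotent pair generates an invertible ideal.\<close>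

section \<open>The ring in coordinates\<close>

definition quad :: "int \<Rightarrow> int \<Rightarrow> int \<Rightarrow> complex" where
  "quad d x y = of_int x + of_int y * csqrt (- of_int d)"

lemma csqrt_neg_of_int_squared: "csqrt (- of_int d) * csqrt (- of_int d) = - of_int d"
  by (metis power2_csqrt power2_eq_square)

lemma csqrt_neg_of_int_pos: "d > 0 \<Longrightarrow> csqrt (- of_int d) = \<i> * of_real (sqrt (of_int d))"
  by (rule csqrt_unique) (auto simp: power_mult_distrib simp flip: of_real_power)

lemma quad_Re_Im:
  assumes "d > 0"
  shows "Re (quad d x y) = of_int x" "Im (quad d x y) = of_int y * sqrt (of_int d)"
  using assms by (auto simp: quad_def csqrt_neg_of_int_pos)

lemma quad_eq_iff: "d > 0 \<Longrightarrow> quad d x y = quad d u v \<longleftrightarrow> x = u \<and> y = v"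
  by (auto simp: complex_eq_iff quad_Re_Im)

lemma quad_add: "quad d x y + quad d u v = quad d (x + u) (y + v)"
  by (simp add: quad_def algebra_simps)

lemma quad_diff: "quad d x y - quad d u v = quad d (x - u) (y - v)"
  by (simp add: quad_def algebra_simps)

lemma quad_mult: "quad d x y * quad d u v = quad d (x * u - d * y * v) (x * v + y * u)"
proof -
  have "quad d x y * quad d u v = of_int x * of_int u
      + of_int y * of_int v * (csqrt (- of_int d) * csqrt (- of_int d))
      + (of_int x * of_int v + of_int y * of_int u) * csqrt (- of_int d)"
    by (simp add: quad_def algebra_simps)
  also have "\<dots> = quad d (x * u - d * y * v) (x * v + y * u)"
    unfolding csqrt_neg_of_int_squared by (simp add: quad_def algebra_simps)
  finally show ?thesis .
qed

lemma quad_of_int: "quad d x 0 = of_int x"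
  by (simp add: quad_def)

lemma carrier_Z_sqrt_neg_iff: "z \<in> carrier (Z_sqrt_neg d) \<longleftrightarrow> (\<exists>x y. z = quad d x y)"
  by (auto simp: Z_sqrt_neg_def quad_def)

lemma carrier_Z_sqrt_negE:
  assumes "z \<in> carrier (Z_sqrt_neg d)"
  obtains x y where "z = quad d x y"
  using assms by (auto simp: carrier_Z_sqrt_neg_iff)

lemma quad_in_carrier: "quad d x y \<in> carrier (Z_sqrt_neg d)"
  by (auto simp: carrier_Z_sqrt_neg_iff)

lemma Z_sqrt_neg_ops [simp]:
  "x \<otimes>\<^bsub>Z_sqrt_neg d\<^esub> y = x * y" "x \<oplus>\<^bsub>Z_sqrt_neg d\<^esub> y = x + y"
  "\<one>\<^bsub>Z_sqrt_neg d\<^esub> = 1" "\<zero>\<^bsub>Z_sqrt_neg d\<^esub> = 0"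
  by (auto simp: Z_sqrt_neg_def ring_of_type_algebra_def)

lemma carrier_Z_sqrt_neg_closed:
  assumes "x \<in> carrier (Z_sqrt_neg d)" "y \<in> carrier (Z_sqrt_neg d)"
  shows "x + y \<in> carrier (Z_sqrt_neg d)" "x - y \<in> carrier (Z_sqrt_neg d)"
    "x * y \<in> carrier (Z_sqrt_neg d)"
proof -
  obtain a b c e where "x = quad d a b" "y = quad d c e"
    using assms carrier_Z_sqrt_neg_iff by metis
  thus "x + y \<in> carrier (Z_sqrt_neg d)" "x - y \<in> carrier (Z_sqrt_neg d)"
    "x * y \<in> carrier (Z_sqrt_neg d)"
    by (simp_all add: quad_add quad_diff quad_mult quad_in_carrier)
qed

lemma of_int_in_carrier: "of_int n \<in> carrier (Z_sqrt_neg d)"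
  by (metis quad_of_int quad_in_carrier)

lemma one_zero_in_carrier: "1 \<in> carrier (Z_sqrt_neg d)" "0 \<in> carrier (Z_sqrt_neg d)"
  using of_int_in_carrier[of 1] of_int_in_carrier[of 0] by simp_all

lemma Z_sqrt_neg_minus:
  assumes "x \<in> carrier (Z_sqrt_neg d)" "y \<in> carrier (Z_sqrt_neg d)"
  shows "x \<ominus>\<^bsub>Z_sqrt_neg d\<^esub> y = x - y"
proof -
  interpret domain "Z_sqrt_neg d" by (rule domain_Z_sqrt_neg)
  have "- y \<in> carrier (Z_sqrt_neg d)"
    using carrier_Z_sqrt_neg_closed(2)[OF one_zero_in_carrier(2) assms(2)] by simp
  hence "\<ominus>\<^bsub>Z_sqrt_neg d\<^esub> y = - y"
    using assms by (intro minus_equality) simp_all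
  thus ?thesis by (simp add: a_minus_def)
qed

section \<open>Ideals in terms of complex arithmetic\<close>

lemma PIdl_Z_sqrt_neg: "PIdl\<^bsub>Z_sqrt_neg d\<^esub> b = {r * b | r. r \<in> carrier (Z_sqrt_neg d)}"
  by (simp add: cgenideal_def)

lemma ideal_Z_sqrt_neg_iff:
  "ideal I (Z_sqrt_neg d) \<longleftrightarrow> I \<subseteq> carrier (Z_sqrt_neg d) \<and> 0 \<in> I \<and>
     (\<forall>x\<in>I. \<forall>y\<in>I. x + y \<in> I) \<and> (\<forall>r\<in>carrier (Z_sqrt_neg d). \<forall>x\<in>I. r * x \<in> I)"
  (is "?l \<longleftrightarrow> ?r")
proof
  assume ?l
  then interpret ideal I "Z_sqrt_neg d" .
  show ?r
    using a_subset additive_subgroup.zero_closed[OF is_additive_subgroup]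
      additive_subgroup.a_closed[OF is_additive_subgroup] I_l_closed by simp
next
  assume r: ?r
  interpret domain "Z_sqrt_neg d" by (rule domain_Z_sqrt_neg)
  show ?l
  proof (rule idealI)
    show "ring (Z_sqrt_neg d)" by (rule ring_axioms)
    show "subgroup I (add_monoid (Z_sqrt_neg d))"
    proof (rule add.subgroupI)
      fix x assume x: "x \<in> I"
      have "- 1 \<in> carrier (Z_sqrt_neg d)" using of_int_in_carrier[of "-1"] by simp
      hence "- x \<in> I" using r x by (metis mult_minus1)
      moreover have "\<ominus>\<^bsub>Z_sqrt_neg d\<^esub> x = - x"
        using r x \<open>- x \<in> I\<close> by (intro minus_equality) auto
      ultimately show "\<ominus>\<^bsub>Z_sqrt_neg d\<^esub> x \<in> I" by simp
    qed (use r in auto)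
  next
    fix a x assume "a \<in> I" "x \<in> carrier (Z_sqrt_neg d)"
    thus "x \<otimes>\<^bsub>Z_sqrt_neg d\<^esub> a \<in> I" "a \<otimes>\<^bsub>Z_sqrt_neg d\<^esub> x \<in> I"
      using r by (auto simp: mult.commute)
  qed
qed

lemma ideal_mult_closed:
  "ideal I (Z_sqrt_neg d) \<Longrightarrow> x \<in> I \<Longrightarrow> r \<in> carrier (Z_sqrt_neg d) \<Longrightarrow> r * x \<in> I"
  unfolding ideal_Z_sqrt_neg_iff by blast

lemma ideal_add_closed:
  "ideal I (Z_sqrt_neg d) \<Longrightarrow> x \<in> I \<Longrightarrow> y \<in> I \<Longrightarrow> x + y \<in> I"
  unfolding ideal_Z_sqrt_neg_iff by blast

lemma ideal_diff_closed:
  assumes "ideal I (Z_sqrt_neg d)" "x \<in> I" "y \<in> I"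
  shows "x - y \<in> I"
  using ideal_add_closed[OF assms(1,2) ideal_mult_closed[OF assms(1,3) of_int_in_carrier[of "-1"]]]
  by simp

lemma principalideal_Z_sqrt_neg_iff:
  "principalideal I (Z_sqrt_neg d) \<longleftrightarrow> (\<exists>g\<in>carrier (Z_sqrt_neg d). I = PIdl\<^bsub>Z_sqrt_neg d\<^esub> g)"
proof -
  interpret domain "Z_sqrt_neg d" by (rule domain_Z_sqrt_neg)
  show ?thesis
    using cgenideal_eq_genideal cgenideal_is_principalideal principalideal.generate by metis
qed

lemma idempotent_pair_Z_sqrt_neg_iff:
  "idempotent_pair (Z_sqrt_neg d) a b \<longleftrightarrow>
     a \<in> carrier (Z_sqrt_neg d) \<and> b \<in> carrier (Z_sqrt_neg d) \<and>
     (a * (1 - a) \<in> PIdl\<^bsub>Z_sqrt_neg d\<^esub> b \<or> b * (1 - b) \<in> PIdl\<^bsub>Z_sqrt_neg d\<^esub> a)"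
  by (auto simp: idempotent_pair_def Z_sqrt_neg_minus one_zero_in_carrier)

lemma Idl_Z_sqrt_neg_props:
  assumes "S \<subseteq> carrier (Z_sqrt_neg d)"
  shows "ideal (Idl\<^bsub>Z_sqrt_neg d\<^esub> S) (Z_sqrt_neg d)" "S \<subseteq> Idl\<^bsub>Z_sqrt_neg d\<^esub> S"
    "ideal I (Z_sqrt_neg d) \<Longrightarrow> S \<subseteq> I \<Longrightarrow> Idl\<^bsub>Z_sqrt_neg d\<^esub> S \<subseteq> I"
proof -
  interpret domain "Z_sqrt_neg d" by (rule domain_Z_sqrt_neg)
  show "ideal (Idl\<^bsub>Z_sqrt_neg d\<^esub> S) (Z_sqrt_neg d)" "S \<subseteq> Idl\<^bsub>Z_sqrt_neg d\<^esub> S"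
    "ideal I (Z_sqrt_neg d) \<Longrightarrow> S \<subseteq> I \<Longrightarrow> Idl\<^bsub>Z_sqrt_neg d\<^esub> S \<subseteq> I"
    using assms by (auto intro: genideal_ideal genideal_self genideal_minimal
        simp: subsetD[OF genideal_self] subsetD[OF genideal_minimal])
qed


section \<open>Idempotent pairs generating a nonprincipal ideal\<close>

text \<open>This is the kernel of the homomorphism to the integers modulo \<open>m\<close> that
  sends \<open>w\<close> to \<open>-s\<close>; it respects \<open>w^2 = -d\<close> because
  \<open>m\<close> divides \<open>s^2 + d\<close>.\<close>

lemma congruence_ideal:
  fixes d m s :: int
  assumes d: "d > 0" and ms: "m dvd s\<^sup>2 + d"
  shows "ideal {quad d p q | p q. m dvd p - s * q} (Z_sqrt_neg d)"
proof -
  have mul: "m dvd (x * p - d * y * q) - s * (x * q + y * p)" if "m dvd p - s * q" for x y p q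
  proof -
    have "(x * p - d * y * q) - s * (x * q + y * p)
        = x * (p - s * q) - y * s * (p - s * q) - y * q * (s\<^sup>2 + d)"
      by (simp add: algebra_simps power2_eq_square)
    thus ?thesis using that ms by (metis dvd_diff dvd_mult)
  qed
  have add: "m dvd (p + p') - s * (q + q')" if "m dvd p - s * q" "m dvd p' - s * q'" for p q p' q'
    using dvd_add[OF that] by (simp add: algebra_simps)
  let ?L = "{quad d p q | p q. m dvd p - s * q}"
  have L: "quad d p q \<in> ?L" if "m dvd p - s * q" for p q using that by blast
  have "?L \<subseteq> carrier (Z_sqrt_neg d)" by (auto simp: quad_in_carrier)
  moreover have "0 \<in> ?L" using L[of 0 0] by (simp add: quad_of_int)
  moreover have "x + y \<in> ?L" if xy: "x \<in> ?L" "y \<in> ?L" for x y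
  proof -
    obtain p q p' q' where "x = quad d p q" "m dvd p - s * q" "y = quad d p' q'" "m dvd p' - s * q'"
      using xy by blast
    thus ?thesis using L[OF add] by (simp add: quad_add)
  qed
  moreover have "r * x \<in> ?L" if r: "r \<in> carrier (Z_sqrt_neg d)" and x: "x \<in> ?L" for r x
  proof -
    obtain p q where "x = quad d p q" "m dvd p - s * q" using x by blast
    moreover obtain u v where "r = quad d u v" using r by (rule carrier_Z_sqrt_negE)
    ultimately show ?thesis using L[OF mul] by (simp add: quad_mult)
  qed
  ultimately show ?thesis by (simp only: ideal_Z_sqrt_neg_iff) simp
qed

text \<open>Multiplicativity of the norm, with the coordinates from \<open>quad_mult\<close>
  (Brahmagupta's identity).\<close>

lemma norm_quad_mult:
  fixes x y u v d :: int
  shows "(x * u - d * y * v)\<^sup>2 + d * (x * v + y * u)\<^sup>2 = (x\<^sup>2 + d * y\<^sup>2) * (u\<^sup>2 + d * v\<^sup>2)"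
  by (simp add: algebra_simps power2_eq_square)

text \<open>A generator \<open>g = u + v w\<close> has norm \<open>m k\<close>, and taking norms in
  \<open>m = (e + f w) g\<close> gives \<open>m = (e^2 + d f^2) k\<close>. If
  \<open>v \<noteq> 0\<close>, then \<open>k \<ge> 2\<close> since \<open>m\<close> is no such norm,
  so \<open>m < 2 d\<close> forces \<open>f = 0\<close>, whence \<open>e v = 0\<close> and
  \<open>m = 0\<close>.\<close>

lemma not_principal_if_not_norm:
  fixes d m s :: int
  assumes d: "d > 0" and m: "1 < m" "m < 2 * d" and ms: "m dvd s\<^sup>2 + d"
    and nn: "\<And>u v. v \<noteq> 0 \<Longrightarrow> u\<^sup>2 + d * v\<^sup>2 \<noteq> m"
    and I: "quad d m 0 \<in> I" "quad d s 1 \<in> I"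
    and sub: "I \<subseteq> {quad d p q | p q. m dvd p - s * q}"
  shows "\<not> principalideal I (Z_sqrt_neg d)"
proof
  assume "principalideal I (Z_sqrt_neg d)"
  then obtain g where g: "g \<in> carrier (Z_sqrt_neg d)" "I = PIdl\<^bsub>Z_sqrt_neg d\<^esub> g"
    unfolding principalideal_Z_sqrt_neg_iff by blast
  from g(1) obtain u v where "g = quad d u v" by (rule carrier_Z_sqrt_negE)
  with g(2) have Ig: "I = {r * quad d u v | r. r \<in> carrier (Z_sqrt_neg d)}"
    by (simp add: PIdl_Z_sqrt_neg)
  have "1 * quad d u v \<in> I" unfolding Ig using one_zero_in_carrier by blast
  then obtain p q where "quad d u v = quad d p q" "m dvd p - s * q" using sub by auto
  hence uv: "m dvd u - s * v" using quad_eq_iff[OF d] by simp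
  have "u\<^sup>2 + d * v\<^sup>2 = (u - s * v) * (u + s * v) + (s\<^sup>2 + d) * v\<^sup>2"
    by (simp add: algebra_simps power2_eq_square)
  also have "m dvd \<dots>" by (rule dvd_add[OF dvd_mult2[OF uv] dvd_mult2[OF ms]])
  finally have "m dvd u\<^sup>2 + d * v\<^sup>2" .
  then obtain k where k: "u\<^sup>2 + d * v\<^sup>2 = m * k" ..
  obtain e f where "quad d m 0 = quad d e f * quad d u v"
    using I(1) unfolding Ig carrier_Z_sqrt_neg_iff by blast
  hence ef: "m = e * u - d * f * v" "0 = e * v + f * u"
    unfolding quad_mult quad_eq_iff[OF d] by auto
  obtain e' f' where "quad d s 1 = quad d e' f' * quad d u v"
    using I(2) unfolding Ig carrier_Z_sqrt_neg_iff by blast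
  hence ef': "s = e' * u - d * f' * v" "1 = e' * v + f' * u"
    unfolding quad_mult quad_eq_iff[OF d] by auto
  have "m\<^sup>2 = (e\<^sup>2 + d * f\<^sup>2) * (m * k)"
    using norm_quad_mult[of e u d f v] ef k by simp
  hence mk: "m = (e\<^sup>2 + d * f\<^sup>2) * k" using m by (simp add: power2_eq_square)
  show False
  proof (cases "v = 0")
    case True
    \<comment> \<open>The generator is the integer \<open>u\<close>, which divides the coefficient 1
      of \<open>w\<close> in \<open>s + w\<close>.\<close>
    hence "u dvd 1" using ef' by (metis dvd_triv_right mult_zero_right add_0)
    hence "m dvd 1" using uv True by (metis dvd_trans diff_zero mult_zero_right)
    thus False using m by simp
  next
    case False
    hence "m * k \<noteq> 0" using k d
      by (metis add_nonneg_eq_0_iff less_imp_le mult_nonneg_nonneg mult_eq_0_iff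
          zero_le_power2 power2_eq_square less_irrefl)
    moreover have "m * k \<ge> 0" using k[symmetric] d by simp
    ultimately have "k > 0" using m by (simp add: zero_less_mult_iff zero_le_mult_iff)
    moreover have "k \<noteq> 1" using nn[OF False] k by auto
    ultimately have k2: "k \<ge> 2" by simp
    have "f = 0"
    proof (rule ccontr)
      assume "f \<noteq> 0"
      hence "f\<^sup>2 \<ge> 1" by (metis zero_less_power2 int_one_le_iff_zero_less)
      hence "d * 1 \<le> d * f\<^sup>2" using d by (intro mult_left_mono) auto
      hence "d \<le> e\<^sup>2 + d * f\<^sup>2" using zero_le_power2[of e] by linarith
      hence "d * 2 \<le> m" unfolding mk using k2 d by (intro mult_mono) auto
      thus False using m by simp
    qed
    thus False using ef False m by auto
  qed
qed

lemma not_princ_if_not_norm: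
  fixes d m s :: int
  assumes d: "d > 0" and m: "1 < m" "m < 2 * d" "odd m" "coprime m d" and ms: "m dvd s\<^sup>2 + d"
    and nn: "\<And>u v. v \<noteq> 0 \<Longrightarrow> u\<^sup>2 + d * v\<^sup>2 \<noteq> m"
  shows "\<not> princ (Z_sqrt_neg d)"
proof -
  have "coprime m s"
  proof (rule coprimeI)
    fix c assume c: "c dvd m" "c dvd s"
    hence "c dvd s\<^sup>2 + d" "c dvd s\<^sup>2" using ms by (auto simp: power2_eq_square)
    hence "c dvd d" using dvd_add_right_iff by blast
    thus "is_unit c" using c m coprime_common_divisor by blast
  qed
  hence "coprime (2 * s) m" using m by (simp add: coprime_commute)
  then obtain y k where yk: "y * (2 * s) + k * m = 1"
    by (metis bezout_int coprime_imp_gcd_eq_1)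
  let ?a = "quad d (y * s) y" and ?b = "quad d m 0"
  have yk': "1 - y * (2 * s) = k * m" using yk by simp
  obtain l where l: "s\<^sup>2 + d = m * l" using ms ..
  have "?a * (1 - ?a) = quad d (y * s) y * quad d (1 - y * s) (- y)"
    using quad_diff[of d 1 0 "y * s" y] by (simp add: quad_of_int)
  \<comment> \<open>The first coordinate is \<open>y s (1 - 2 s y) + y^2 (s^2 + d)\<close>; both
    summands are multiples of \<open>m\<close>.\<close>
  also have "\<dots> = quad d (y * s * k + y\<^sup>2 * l) (y * k) * ?b"
  proof -
    have "y * s * (1 - y * s) - d * y * (- y) = y * s * (1 - y * (2 * s)) + y\<^sup>2 * (s\<^sup>2 + d)"
      by (simp add: algebra_simps power2_eq_square)
    also have "\<dots> = (y * s * k + y\<^sup>2 * l) * m"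
      unfolding l yk' by (simp add: algebra_simps)
    finally have *: "y * s * (1 - y * s) - d * y * (- y) = (y * s * k + y\<^sup>2 * l) * m" .
    have "y * s * (- y) + y * (1 - y * s) = y * (1 - y * (2 * s))"
      by (simp add: algebra_simps)
    also have "\<dots> = y * k * m" unfolding yk' by (simp add: algebra_simps)
    finally show ?thesis using * by (simp add: quad_mult)
  qed
  finally have "?a * (1 - ?a) \<in> PIdl\<^bsub>Z_sqrt_neg d\<^esub> ?b"
    unfolding PIdl_Z_sqrt_neg using quad_in_carrier by blast
  hence ip: "idempotent_pair (Z_sqrt_neg d) ?a ?b"
    by (simp add: idempotent_pair_Z_sqrt_neg_iff quad_in_carrier)
  let ?I = "Idl\<^bsub>Z_sqrt_neg d\<^esub> {?a, ?b}"
  have ab: "{?a, ?b} \<subseteq> carrier (Z_sqrt_neg d)" by (simp add: quad_in_carrier)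
  note I = Idl_Z_sqrt_neg_props[OF ab]
  have "{?a, ?b} \<subseteq> {quad d p q | p q. m dvd p - s * q}"
    by (auto simp: quad_eq_iff[OF d])
  hence sub: "?I \<subseteq> {quad d p q | p q. m dvd p - s * q}"
    using I(3) congruence_ideal[OF d ms] by blast
  \<comment> \<open>Since \<open>2 s y = 1 - k m\<close>, the product \<open>2 s a\<close> is
    \<open>(1 - k m)(s + w)\<close>; adding \<open>k (s + w) m\<close> recovers
    \<open>s + w\<close>.\<close>
  have "quad d (2 * s) 0 * ?a + quad d (k * s) k * ?b = quad d s 1"
  proof -
    have "s * (y * (2 * s) + k * m) = s" using yk by simp
    thus ?thesis using yk by (simp add: quad_mult quad_add quad_eq_iff[OF d] algebra_simps)
  qed
  moreover have "quad d (2 * s) 0 * ?a + quad d (k * s) k * ?b \<in> ?I"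
    using I(1,2) quad_in_carrier by (intro ideal_add_closed ideal_mult_closed) auto
  ultimately have "\<not> principalideal ?I (Z_sqrt_neg d)"
    using not_principal_if_not_norm[OF d m(1,2) ms nn _ _ sub] I(2) by auto
  thus ?thesis using ip unfolding princ_def by blast
qed

lemma not_princ_if_small_divisor:
  fixes d m s :: int
  assumes "1 < m" "m < d" "odd m" "coprime m d" "m dvd s\<^sup>2 + d"
  shows "\<not> princ (Z_sqrt_neg d)"
proof (rule not_princ_if_not_norm)
  fix u v :: int assume "v \<noteq> 0"
  hence "v\<^sup>2 \<ge> 1" by (metis zero_less_power2 int_one_le_iff_zero_less)
  hence "d * 1 \<le> d * v\<^sup>2" using assms by (intro mult_left_mono) auto
  thus "u\<^sup>2 + d * v\<^sup>2 \<noteq> m" using zero_le_power2[of u] assms by linarith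
qed (use assms in auto)


section \<open>Choice of the modulus for each remaining \<open>d\<close>\<close>

text \<open>Applied to \<open>d = 8 m - 9\<close> and \<open>d = 16 m - 49\<close>, it reduces
  coprimality of \<open>m\<close> and \<open>d\<close> to 3 or 7 not dividing
  \<open>m\<close>.\<close>

lemma coprime_mult_diff:
  fixes m c k :: int
  assumes "coprime m k"
  shows "coprime m (c * m - k)"
proof (rule coprimeI)
  fix x assume x: "x dvd m" "x dvd c * m - k"
  have "x dvd c * m - (c * m - k)" by (rule dvd_diff[OF dvd_mult[OF x(1)] x(2)])
  moreover have "c * m - (c * m - k) = k" by simp
  ultimately show "is_unit x" using assms x(1) coprime_common_divisor by metis
qed

lemma not_princ_mersenne:
  fixes d :: int
  assumes sf: "squarefree d" and d: "d = 2 ^ k - 1" and k: "k \<ge> 4"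
  shows "\<not> princ (Z_sqrt_neg d)"
proof -
  consider "odd k" | "k = 4" | "even k" "k > 4" using k by fastforce
  thus ?thesis
  proof cases
    case 1
    then obtain j where j: "k = 2 * j + 1" by (rule oddE)
    then obtain i where i: "j = Suc i" using k by (cases j) auto
    hence i0: "i > 0" using j k by simp
    define m :: int where "m = 4 ^ i + 1"
    have dm: "d = 8 * m - 9" by (simp add: d j i m_def power_mult)
    have m4: "m mod 3 = 2" unfolding m_def
      by (induction i) (auto simp: mod_simps, presburger)
    have "\<not> 3 dvd m" using m4 by presburger
    moreover have "prime (3::int)" by simp
    ultimately have "coprime m 3" by (metis coprime_commute prime_imp_coprime)
    hence "coprime m 9" using coprime_power_right_iff[of m 3 2] by simp
    hence cop: "coprime m d" unfolding dm by (rule coprime_mult_diff)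
    show ?thesis
    proof (rule not_princ_if_small_divisor[of m d 3])
      have "(4::int) ^ i \<ge> 4 ^ 1" using i0 by (intro power_increasing) auto
      thus "1 < m" "m < d" unfolding dm by (auto simp: m_def)
      show "odd m" using i0 by (simp add: m_def)
      show "m dvd 3\<^sup>2 + d" by (simp add: dm)
      show "coprime m d" by (rule cop)
    qed
  next
    case 2
    have dv: "d = 15" using d 2 by simp
    \<comment> \<open>Here \<open>6^2 + 15 = 3 * 17\<close>, but 17 exceeds \<open>d\<close>, so
      norms with \<open>v \<noteq> 0\<close> are ruled out by hand: \<open>v^2 = 1\<close> would
      need \<open>u^2 = 2\<close>.\<close>
    show ?thesis
    proof (rule not_princ_if_not_norm[of d 17 6])
      have "prime (17::int)" by simp
      thus "coprime 17 d" unfolding dv by (rule prime_imp_coprime) simp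
      fix u v :: int assume "v \<noteq> 0"
      show "u\<^sup>2 + d * v\<^sup>2 \<noteq> 17"
      proof
        assume eq: "u\<^sup>2 + d * v\<^sup>2 = 17"
        have "\<bar>v\<bar> \<ge> 1" using \<open>v \<noteq> 0\<close> by simp
        moreover have "\<bar>v\<bar> < 2"
        proof (rule ccontr)
          assume "\<not> \<bar>v\<bar> < 2"
          hence "\<bar>v\<bar>\<^sup>2 \<ge> 2\<^sup>2" by (intro power_mono) auto
          thus False using eq zero_le_power2[of u] unfolding dv by simp
        qed
        ultimately have "\<bar>v\<bar> = 1" by simp
        hence "v\<^sup>2 = 1" by (metis power2_abs one_power2)
        hence u2: "u\<^sup>2 = 2" using eq dv by simp
        have "\<bar>u\<bar> < 2" by (rule power2_less_imp_less) (simp_all add: u2)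
        hence "u \<in> {-1, 0, 1}" by auto
        thus False using u2 by auto
      qed
    qed (simp_all add: dv)
  next
    case 3
    then obtain j where j: "k = 2 * j" by blast
    define i where "i = j - 2"
    have i: "j = Suc (Suc i)" using 3 j by (simp add: i_def)
    hence i0: "i > 0" using j 3 by simp
    define m :: int where "m = 4 ^ i + 3"
    have dm: "d = 16 * m - 49" by (simp add: d j i m_def power_mult)
    have m7: "\<not> 7 dvd m"
    proof
      assume "7 dvd m"
      hence "7 dvd d" unfolding dm by simp
      hence "(7::int) dvd 4 ^ j - 1" unfolding d j power_mult by simp
      hence e7: "(4::int) ^ j mod 7 = 1" using mod_eq_dvd_iff[of "4 ^ j" "7::int" 1] by simp
      \<comment> \<open>The order of 4 modulo 7 is 3, and \<open>4^3 = 64\<close> is 1 modulo both 7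
        and 9. So \<open>4^j = 1\<close> modulo 7 forces \<open>3 dvd j\<close>, and then 9 divides
        \<open>d\<close>.\<close>
      have e64: "(4::int) ^ j = 64 ^ (j div 3) * 4 ^ (j mod 3)"
      proof -
        have "(4::int) ^ j = 4 ^ (3 * (j div 3) + j mod 3)" by simp
        thus ?thesis by (simp only: power_add power_mult) simp
      qed
      have p1: "(64::int) ^ n mod 7 = 1" "(64::int) ^ n mod 9 = 1" for n
        using power_mod[of "64::int" 7 n] power_mod[of "64::int" 9 n] by simp_all
      have "(4::int) ^ (j mod 3) mod 7 = 1"
        using e7 unfolding e64 by (metis mod_mult_left_eq p1(1) mult_1)
      moreover have "j mod 3 \<in> {0, 1, 2}" by auto
      ultimately have "j mod 3 = 0" by auto
      hence "(4::int) ^ j mod 9 = 1" using e64 p1(2) by simp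
      hence "(9::int) dvd 4 ^ j - 1" using mod_eq_dvd_iff[of "4 ^ j" "9::int" 1] by simp
      hence "3\<^sup>2 dvd d" unfolding d j power_mult by simp
      hence "is_unit (3::int)" using sf squarefreeD by blast
      thus False by simp
    qed
    have "prime (7::int)" by simp
    hence "coprime m 7" using m7 by (metis coprime_commute prime_imp_coprime)
    hence "coprime m 49" using coprime_power_right_iff[of m 7 2] by simp
    hence cop: "coprime m d" unfolding dm by (rule coprime_mult_diff)
    show ?thesis
    proof (rule not_princ_if_small_divisor[of m d 7])
      have "(4::int) ^ i \<ge> 4 ^ 1" using i0 by (intro power_increasing) auto
      thus "1 < m" "m < d" unfolding dm by (auto simp: m_def)
      show "odd m" using i0 by (simp add: m_def)
      show "m dvd 7\<^sup>2 + d" by (simp add: dm)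
      show "coprime m d" by (rule cop)
    qed
  qed
qed

lemma not_princ_Z_sqrt_neg:
  fixes d :: int
  assumes d: "d > 0" and sf: "squarefree d" and ex: "d \<notin> {1, 2, 3, 7}"
  shows "\<not> princ (Z_sqrt_neg d)"
proof (cases "even d")
  case True
  then obtain e where e: "d = 2 * e" by blast
  have "odd e"
  proof
    assume "even e"
    hence "2\<^sup>2 dvd d" unfolding e by auto
    hence "is_unit (2::int)" using sf squarefreeD by blast
    thus False by simp
  qed
  hence "e \<noteq> 2" by auto
  \<comment> \<open>The bound is what \<open>e + 2 < 2 e = d\<close> requires; \<open>e = 1\<close>
    is the excluded \<open>d = 2\<close>.\<close>
  hence e3: "e \<ge> 3" using ex e d by auto
  have "coprime (e + 2) 2" using \<open>odd e\<close> by simp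
  moreover have "coprime (e + 2) e"
    using \<open>odd e\<close> by (simp add: coprime_iff_gcd_eq_1 gcd.commute[of _ e])
      (metis coprime_iff_gcd_eq_1 coprime_right_2_iff_odd)
  ultimately have cop: "coprime (e + 2) d" by (simp add: e)
  have "2\<^sup>2 + d = (e + 2) * 2" by (simp add: e)
  hence "e + 2 dvd 2\<^sup>2 + d" by (metis dvd_triv_left)
  thus ?thesis
    using not_princ_if_small_divisor[of "e + 2" d 2] e3 \<open>odd e\<close> cop e by simp
next
  case False
  obtain m where m: "d + 1 = 2 ^ multiplicity 2 (d + 1) * m" "\<not> 2 dvd m"
    using multiplicity_decompose'[of "d + 1" 2] d by auto
  define k where "k = multiplicity 2 (d + 1)"
  have k0: "k > 0" using False m(1) m(2) unfolding k_def by (cases "multiplicity 2 (d + 1)") auto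
  have dk: "d = 2 ^ k * m - 1" using m(1) k_def by simp
  have m0: "m > 0" using d m(1) by (metis zero_less_mult_pos zero_less_power zero_less_numeral
        add_pos_pos zero_less_one)
  show ?thesis
  proof (cases "m = 1")
    case True
    \<comment> \<open>These exponents give the excluded values 1, 3 and 7.\<close>
    have "k \<noteq> 1" "k \<noteq> 2" "k \<noteq> 3" using ex dk True by auto
    hence "k \<ge> 4" using k0 by simp
    thus ?thesis using not_princ_mersenne[OF sf] dk True by simp
  next
    case False
    hence m3: "m > 1" using m0 by simp
    have "(2::int) ^ k \<ge> 2 ^ 1" using k0 by (intro power_increasing) auto
    hence "2 * m \<le> 2 ^ k * m" using m0 by (intro mult_right_mono) auto
    hence "m < d" using dk m3 by linarith
    moreover have dv: "m dvd 1\<^sup>2 + d" by (simp add: dk)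
    moreover have "coprime m d"
    proof (rule coprimeI)
      fix c assume "c dvd m" "c dvd d"
      thus "is_unit c" using dv by (metis dvd_add_left_iff dvd_trans one_power2)
    qed
    ultimately show ?thesis using not_princ_if_small_divisor[of m d 1] m3 m(2) by simp
  qed
qed

section \<open>Ideals for \<open>d = 1, 2, 3, 7\<close>\<close>

text \<open>\<open>P x y\<close> stands for membership of \<open>x + y\<surd>(-d)\<close> in the lattice. For \<open>d = 7\<close> the point
  itself need not have norm less than \<open>1\<close>; then its double or its triple is close to a ring element.\<close>
lemma lattice_without_short_vectors:
  fixes d :: int and P :: "real \<Rightarrow> real \<Rightarrow> bool"
  assumes d: "d \<in> {1, 2, 3, 7}"
    and diff: "\<And>x y a b. P x y \<Longrightarrow> P (x - of_int a) (y - of_int b)"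
    and add: "\<And>x y u v. P x y \<Longrightarrow> P u v \<Longrightarrow> P (x + u) (y + v)"
    and rot: "\<And>x y. P x y \<Longrightarrow> P (- of_int d * y) x"
    and min: "\<And>x y. P x y \<Longrightarrow> x\<^sup>2 + of_int d * y\<^sup>2 < 1 \<Longrightarrow> x = 0 \<and> y = 0"
    and P: "P x y" and xy: "\<bar>x\<bar> \<le> 1/2" "\<bar>y\<bar> \<le> 1/2"
  shows "(x = 0 \<and> y = 0) \<or> (d \<in> {3, 7} \<and> \<bar>x\<bar> = 1/2 \<and> \<bar>y\<bar> = 1/2)"
proof (rule ccontr)
  assume neg: "\<not> ?thesis"
  have half: "t\<^sup>2 \<le> 1/4" if "\<bar>t\<bar> \<le> 1/2" for t :: real
    using power_mono[OF that, of 2] by (simp add: power2_eq_square)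
  have half': "t\<^sup>2 < 1/4" if "\<bar>t\<bar> \<le> 1/2" "\<bar>t\<bar> \<noteq> 1/2" for t :: real
    using power_strict_mono[of "\<bar>t\<bar>" "1/2" 2] that by (simp add: power2_eq_square)
  note hx = half[OF xy(1)] and hy = half[OF xy(2)]
  have ge1: "x\<^sup>2 + of_int d * y\<^sup>2 \<ge> 1" using min[OF P] neg by force
  \<comment> \<open>For \<open>d \<le> 3\<close> the norm is at most
    \<open>(1 + d)/4 \<le> 1\<close>, with equality only at the corners for \<open>d = 3\<close>,
    which \<open>neg\<close> excludes.\<close>
  have "d = 7"
  proof (rule ccontr)
    assume "d \<noteq> 7"
    hence "d = 1 \<or> d = 2 \<or> d = 3" using d by auto
    thus False using ge1 hx hy neg half'[OF xy(1)] half'[OF xy(2)] by auto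
  qed
  note d7 = this
  define t where "t = \<bar>y\<bar>"
  define e :: int where "e = (if y < 0 then -1 else 1)"
  have ye: "y = of_int e * t" "e * e = 1" by (auto simp: e_def t_def)
  have e2: "of_int e * of_int e = (1::real)" using ye(2) by (metis of_int_1 of_int_mult)
  have eabs: "\<bar>of_int e\<bar> = (1::real)" by (simp add: e_def)
  have t: "0 \<le> t" "t \<le> 1/2" "t\<^sup>2 = y\<^sup>2" using xy by (auto simp: t_def)
  \<comment> \<open>The constant 8/25 lies just below the square root of 3/28. Using it for
    \<open>t\<close> and for \<open>1 - 2 t\<close> confines \<open>t\<close> to a small interval
    around 1/3.\<close>
  have large: "a > 8/25" if "7 * a\<^sup>2 \<ge> 3/4" "a \<ge> 0" for a :: real
  proof (rule ccontr)
    assume "\<not> a > 8/25"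
    hence "a\<^sup>2 \<le> (8/25)\<^sup>2" using that by (intro power_mono) auto
    thus False using that by (simp add: power2_eq_square)
  qed
  have tl: "t > 8/25" using ge1 hx t by (intro large) (auto simp: d7)
  define a where "a = round (2 * x)"
  have P2: "P (2 * x - of_int a) (2 * y - of_int e)" using diff[OF add[OF P P]] by simp
  have a: "\<bar>2 * x - of_int a\<bar> \<le> 1/2"
    unfolding a_def by (metis abs_minus_commute of_int_round_abs_le)
  have ysq: "(c * y - of_int e)\<^sup>2 = (c * t - 1)\<^sup>2" for c
  proof -
    have "c * y - of_int e = of_int e * (c * t - 1)" by (simp add: ye algebra_simps)
    thus ?thesis using e2 by (simp add: power_mult_distrib power2_eq_square[of "of_int e"])
  qed
  have y2: "(2 * y - of_int e)\<^sup>2 = (1 - 2 * t)\<^sup>2" unfolding ysq by (rule power2_commute)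
  show False
  proof (cases "2 * x = of_int a \<and> 2 * y = of_int e")
    case True
    \<comment> \<open>The doubled point is a ring element, so its norm gives no information. Here
      \<open>x = 0\<close> and \<open>y = e/2\<close>; multiplying by \<open>w\<close> gives
      \<open>-7 e/2\<close>, which is \<open>e/2\<close> up to an integer and has norm 1/4.\<close>
    hence yh: "\<bar>y\<bar> = 1/2" using eabs by linarith
    hence "\<bar>x\<bar> \<noteq> 1/2" using neg d7 by auto
    hence "\<bar>of_int a\<bar> < (1::real)" using True xy by linarith
    hence "a = 0" by linarith
    hence x0: "x = 0" using True by simp
    have "- of_int d * y - of_int (- 4 * e) = of_int e / 2" "x - of_int 0 = 0"
      using True d7 x0 by simp_all
    hence "P (of_int e / 2) 0" using diff[OF rot[OF P], of "- 4 * e" 0] by metis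
    moreover have "(of_int e / 2 :: real)\<^sup>2 < 1" using e2 by (simp add: power2_eq_square)
    ultimately show False using min[of "of_int e / 2" 0] ye(2) by auto
  next
    case False
    hence "(2 * x - of_int a)\<^sup>2 + 7 * (2 * y - of_int e)\<^sup>2 \<ge> 1" using min[OF P2] d7 by force
    hence "7 * (1 - 2 * t)\<^sup>2 \<ge> 3/4" using half[OF a] y2 by simp
    hence tu: "1 - 2 * t > 8/25" using t by (intro large) auto
    \<comment> \<open>The tripled point has norm at most \<open>1/4 + 7/100\<close> modulo the ring,
      so it reduces to 0. Then both coordinates are at most 1/3 in absolute value and the original
      norm is at most 8/9.\<close>
    define b where "b = round (3 * x)"
    have P3: "P (3 * x - of_int b) (3 * y - of_int e)" using diff[OF add[OF P add[OF P P]]] by simp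
    have b: "\<bar>3 * x - of_int b\<bar> \<le> 1/2"
      unfolding b_def by (metis abs_minus_commute of_int_round_abs_le)
    have "(3 * y - of_int e)\<^sup>2 = \<bar>3 * t - 1\<bar>\<^sup>2" by (simp add: ysq)
    also have "\<bar>3 * t - 1\<bar> \<le> 1/10" using tl tu by linarith
    hence "\<bar>3 * t - 1\<bar>\<^sup>2 \<le> (1/10)\<^sup>2" by (intro power_mono) auto
    finally have "(3 * x - of_int b)\<^sup>2 + of_int d * (3 * y - of_int e)\<^sup>2 < 1"
      using half[OF b] d7 by (simp add: power2_eq_square)
    hence z: "3 * x = of_int b" "3 * y = of_int e" using min[OF P3] by auto
    have "\<bar>of_int b\<bar> < (2::real)" using z(1) xy by linarith
    hence "b \<in> {-1, 0, 1}" by auto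
    hence "\<bar>x\<bar> \<le> 1/3" using z by auto
    moreover have "\<bar>y\<bar> \<le> 1/3" using z eabs by linarith
    ultimately have "\<bar>x\<bar>\<^sup>2 \<le> (1/3)\<^sup>2" "\<bar>y\<bar>\<^sup>2 \<le> (1/3)\<^sup>2" by (intro power_mono; simp)+
    thus False using ge1 d7 by (simp add: power2_eq_square)
  qed
qed


section \<open>Division by an element of least norm\<close>

lemma complex_in_coordinates:
  assumes "d > 0"
  obtains x y where "z = of_real x + of_real y * csqrt (- of_int d)"
proof
  show "z = of_real (Re z) + of_real (Im z / sqrt (of_int d)) * csqrt (- of_int d)"
    using assms by (simp add: csqrt_neg_of_int_pos complex_eq_iff)
qed

lemma cmod_coordinates:
  assumes "d > 0"
  shows "(cmod (of_real x + of_real y * csqrt (- of_int d)))\<^sup>2 = x\<^sup>2 + of_int d * y\<^sup>2"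
  using assms by (simp add: csqrt_neg_of_int_pos cmod_power2 power_mult_distrib)

lemma ideal_least_norm:
  assumes d: "d > 0" and I: "ideal I (Z_sqrt_neg d)" and z0: "z0 \<in> I" "z0 \<noteq> 0"
  obtains g where "g \<in> I" "g \<noteq> 0" "\<And>z. z \<in> I \<Longrightarrow> cmod z < cmod g \<Longrightarrow> z = 0"
proof -
  \<comment> \<open>On the ideal the squared modulus is already an integer, so the floor changes
    nothing there and allows a minimum over the naturals.\<close>
  define N where "N z = nat \<lfloor>(cmod z)\<^sup>2\<rfloor>" for z
  have N: "(cmod z)\<^sup>2 = real (N z)" if "z \<in> I" for z
  proof -
    have "z \<in> carrier (Z_sqrt_neg d)" using that I by (auto simp: ideal_Z_sqrt_neg_iff)
    then obtain x y where "z = quad d x y" by (rule carrier_Z_sqrt_negE)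
    hence "(cmod z)\<^sup>2 = of_int (x\<^sup>2 + d * y\<^sup>2)"
      using cmod_coordinates[OF d, of "of_int x" "of_int y"] by (simp add: quad_def)
    moreover have "x\<^sup>2 + d * y\<^sup>2 \<ge> 0" using d by simp
    ultimately show ?thesis unfolding N_def by (metis floor_of_int of_nat_nat of_int_of_nat_eq)
  qed
  obtain g where g: "g \<in> I \<and> g \<noteq> 0" "\<And>z. z \<in> I \<and> z \<noteq> 0 \<Longrightarrow> N g \<le> N z"
    using ex_has_least_nat[of "\<lambda>z. z \<in> I \<and> z \<noteq> 0" z0 N] z0 by blast
  show thesis
  proof
    show "g \<in> I" "g \<noteq> 0" using g by auto
    fix z assume z: "z \<in> I" "cmod z < cmod g"
    show "z = 0"
    proof (rule ccontr)
      assume "z \<noteq> 0"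
      hence "(cmod g)\<^sup>2 \<le> (cmod z)\<^sup>2" using g z N by simp
      thus False using z(2) by (metis norm_ge_zero not_le power2_le_imp_le)
    qed
  qed
qed

lemma ideal_principal_or_stable:
  fixes d :: int
  assumes d: "d \<in> {1, 2, 3, 7}" and I: "ideal I (Z_sqrt_neg d)"
  shows "principalideal I (Z_sqrt_neg d) \<or>
    d \<in> {3, 7} \<and> (\<forall>z\<in>I. (1 + csqrt (- of_int d)) / 2 * z \<in> I)"
proof (cases "I = {0}")
  case True
  have "PIdl\<^bsub>Z_sqrt_neg d\<^esub> 0 = {0}"
    using one_zero_in_carrier by (auto simp: PIdl_Z_sqrt_neg)
  thus ?thesis unfolding principalideal_Z_sqrt_neg_iff using True one_zero_in_carrier by blast
next
  case False
  define w where "w = csqrt (- of_int d)"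
  define \<theta> where "\<theta> = (1 + w) / 2"
  have ww: "w * w = - of_int d" unfolding w_def by (rule csqrt_neg_of_int_squared)
  have d0: "d > 0" using d by auto
  have "0 \<in> I" using I by (simp add: ideal_Z_sqrt_neg_iff)
  then obtain z0 where "z0 \<in> I" "z0 \<noteq> 0" using False by blast
  then obtain g where g: "g \<in> I" "g \<noteq> 0" and least: "\<And>z. z \<in> I \<Longrightarrow> cmod z < cmod g \<Longrightarrow> z = 0"
    using ideal_least_norm[OF d0 I] by blast
  have gC: "g \<in> carrier (Z_sqrt_neg d)" using g I by (auto simp: ideal_Z_sqrt_neg_iff)
  \<comment> \<open>This is membership in the lattice \<open>I / g\<close>, in real
    coordinates.\<close>
  define P where "P x y \<longleftrightarrow> (of_real x + of_real y * w) * g \<in> I" for x y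
  have Pdiff: "P (x - of_int a) (y - of_int b)" if "P x y" for x y a b
  proof -
    have "(of_real x + of_real y * w) * g - quad d a b * g \<in> I"
      using ideal_diff_closed[OF I that[unfolded P_def] ideal_mult_closed[OF I g(1) quad_in_carrier]] .
    thus ?thesis by (simp add: P_def quad_def w_def algebra_simps)
  qed
  have Padd: "P (x + u) (y + v)" if "P x y" "P u v" for x y u v
    using ideal_add_closed[OF I that[unfolded P_def]] by (simp add: P_def algebra_simps)
  have Prot: "P (- of_int d * y) x" if "P x y" for x y
  proof -
    have "quad d 0 1 * ((of_real x + of_real y * w) * g) \<in> I"
      by (rule ideal_mult_closed[OF I that[unfolded P_def] quad_in_carrier])
    also have "quad d 0 1 * ((of_real x + of_real y * w) * g)
        = (of_real x * w + of_real y * (w * w)) * g"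
      by (simp add: quad_def w_def algebra_simps)
    finally show ?thesis unfolding ww by (simp add: P_def algebra_simps)
  qed
  have Pmin: "x = 0 \<and> y = 0" if "P x y" "x\<^sup>2 + of_int d * y\<^sup>2 < 1" for x y
  proof -
    have c: "(cmod (of_real x + of_real y * w))\<^sup>2 = x\<^sup>2 + of_int d * y\<^sup>2"
      unfolding w_def by (rule cmod_coordinates[OF d0])
    have "cmod (of_real x + of_real y * w) < 1"
      by (rule power2_less_imp_less) (use c that(2) in simp_all)
    hence "cmod ((of_real x + of_real y * w) * g) < cmod g" using g by (simp add: norm_mult)
    hence "of_real x + of_real y * w = 0" using least that(1) g unfolding P_def by force
    hence "x\<^sup>2 + of_int d * y\<^sup>2 = 0" using c by simp
    moreover have "of_int d * y\<^sup>2 \<ge> 0" using d0 by simp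
    ultimately have "x\<^sup>2 = 0" "of_int d * y\<^sup>2 = 0" using zero_le_power2[of x] by linarith+
    thus ?thesis using d0 by simp
  qed
  have red: "(\<exists>a b. z = quad d a b * g) \<or> d \<in> {3, 7} \<and> (\<exists>a b. z = (quad d a b + \<theta>) * g)"
    if z: "z \<in> I" for z
  proof -
    obtain x y where xy: "z / g = of_real x + of_real y * csqrt (- of_int d)"
      by (rule complex_in_coordinates[OF d0])
    hence zg: "z = (of_real x + of_real y * w) * g" using g by (simp add: w_def field_simps)
    hence "P x y" using z by (simp add: P_def)
    hence Pr: "P (x - of_int (round x)) (y - of_int (round y))" by (rule Pdiff)
    define a b where "a = x - of_int (round x)" and "b = y - of_int (round y)"
    have "\<bar>a\<bar> \<le> 1/2" "\<bar>b\<bar> \<le> 1/2"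
      unfolding a_def b_def by (metis abs_minus_commute of_int_round_abs_le)+
    hence "(a = 0 \<and> b = 0) \<or> (d \<in> {3, 7} \<and> \<bar>a\<bar> = 1/2 \<and> \<bar>b\<bar> = 1/2)"
      using lattice_without_short_vectors[of d P a b, OF d Pdiff Padd Prot Pmin] Pr
      unfolding a_def b_def by blast
    thus ?thesis
    proof
      assume "a = 0 \<and> b = 0"
      hence "x = of_int (round x)" "y = of_int (round y)" by (auto simp: a_def b_def)
      hence "z = quad d (round x) (round y) * g"
        unfolding zg by (metis of_real_of_int_eq quad_def w_def)
      thus ?thesis by blast
    next
      assume ab: "d \<in> {3, 7} \<and> \<bar>a\<bar> = 1/2 \<and> \<bar>b\<bar> = 1/2"
      \<comment> \<open>A remainder of -1/2 becomes 1/2 after shifting by 1, so all four corners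
        give the same class modulo the ring, that of \<open>\<theta>\<close>.\<close>
      have half: "\<exists>n::int. t = of_int n + 1/2" if "\<bar>t - of_int k\<bar> = 1/2" for t :: real and k
      proof (cases "t \<ge> of_int k")
        case True
        thus ?thesis using that by (intro exI[of _ k]) auto
      next
        case False
        thus ?thesis using that by (intro exI[of _ "k - 1"]) auto
      qed
      obtain n m where "x = of_int n + 1/2" "y = of_int m + 1/2"
        using half ab unfolding a_def b_def by meson
      hence "z = (quad d n m + \<theta>) * g" unfolding zg by (simp add: quad_def w_def \<theta>_def algebra_simps add_divide_distrib)
      thus ?thesis using ab by blast
    qed
  qed
  show ?thesis
  proof (cases "\<forall>z\<in>I. \<exists>a b. z = quad d a b * g")
    case True
    have "I = PIdl\<^bsub>Z_sqrt_neg d\<^esub> g"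
      unfolding PIdl_Z_sqrt_neg using True quad_in_carrier ideal_mult_closed[OF I g(1)] by blast
    thus ?thesis unfolding principalideal_Z_sqrt_neg_iff using gC by blast
  next
    case False
    then obtain z a b where z: "z \<in> I" "d \<in> {3, 7}" "z = (quad d a b + \<theta>) * g" using red by blast
    have "z - quad d a b * g \<in> I" using z g I quad_in_carrier by (intro ideal_diff_closed ideal_mult_closed)
    hence \<theta>g: "\<theta> * g \<in> I" using z by (simp add: algebra_simps)
    \<comment> \<open>Both 3 and 7 are -1 modulo 4, so \<open>\<theta>\<close> has integral norm
      \<open>n\<close> and is a root of \<open>X^2 - X + n\<close>; hence multiplication by it
      preserves \<open>I\<close>.\<close>
    define n where "n = (1 + d) div 4"
    have n: "1 + d = 4 * n" using z(2) by (auto simp: n_def)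
    have "\<theta> * \<theta> = (1 + 2 * w + w * w) / 4" by (simp add: \<theta>_def algebra_simps)
    also have "\<dots> = \<theta> - of_int (1 + d) / 4" unfolding ww by (simp add: \<theta>_def field_simps)
    also have "\<dots> = \<theta> - of_int n" unfolding n by simp
    finally have \<theta>\<theta>: "\<theta> * \<theta> = \<theta> - of_int n" .
    have r: "quad d u v * (\<theta> * g) \<in> I" "quad d u v * g \<in> I" for u v
      using \<theta>g g I quad_in_carrier by (auto intro: ideal_mult_closed)
    have "\<theta> * x \<in> I" if "x \<in> I" for x
      using red[OF that]
    proof (elim disjE exE conjE)
      fix u v assume "x = quad d u v * g"
      thus ?thesis using r(1)[of u v] by (simp add: algebra_simps)
    next
      fix u v assume x: "x = (quad d u v + \<theta>) * g"
      have "\<theta> * x = quad d u v * (\<theta> * g) + (\<theta> * \<theta>) * g" unfolding x by (simp add: algebra_simps)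
      also have "\<dots> = quad d u v * (\<theta> * g) + (\<theta> * g - quad d n 0 * g)"
        unfolding \<theta>\<theta> by (simp add: algebra_simps quad_of_int)
      also have "\<dots> \<in> I" using r \<theta>g I by (intro ideal_add_closed ideal_diff_closed)
      finally show ?thesis .
    qed
    thus ?thesis using z(2) by (simp add: \<theta>_def w_def)
  qed
qed

text \<open>For \<open>a(1 - a) \<in> bR\<close> the ideals \<open>(a, b)\<close> and \<open>(1 - a, b)\<close> have product \<open>bR\<close>, so \<open>(a, b)\<close>
  is invertible and cannot be a module over a strictly larger ring.\<close>
lemma multiplier_of_idempotent_pair:
  assumes "a \<in> carrier (Z_sqrt_neg d)" "b \<in> carrier (Z_sqrt_neg d)" "b \<noteq> 0"
    and "a * (1 - a) \<in> PIdl\<^bsub>Z_sqrt_neg d\<^esub> b"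
    and \<theta>: "\<theta> * a \<in> Idl\<^bsub>Z_sqrt_neg d\<^esub> {a, b}" "\<theta> * b \<in> Idl\<^bsub>Z_sqrt_neg d\<^esub> {a, b}"
  shows "\<theta> \<in> carrier (Z_sqrt_neg d)"
proof -
  let ?R = "carrier (Z_sqrt_neg d)"
  define B where "B = PIdl\<^bsub>Z_sqrt_neg d\<^esub> b"
  have B_iff: "x \<in> B \<longleftrightarrow> (\<exists>r\<in>?R. x = r * b)" for x unfolding B_def PIdl_Z_sqrt_neg by blast
  interpret domain "Z_sqrt_neg d" by (rule domain_Z_sqrt_neg)
  have B: "ideal B (Z_sqrt_neg d)" unfolding B_def by (rule cgenideal_ideal[OF assms(2)])
  have ab: "{a, b} \<subseteq> ?R" using assms by simp
  have a1: "1 - a \<in> ?R" using assms one_zero_in_carrier by (intro carrier_Z_sqrt_neg_closed)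
  \<comment> \<open>The elements that \<open>1 - a\<close> multiplies into \<open>bR\<close>: both
    generators belong, so \<open>\<theta> b (1 - a)\<close> is in \<open>bR\<close>. Adding
    \<open>\<theta> a b\<close> leaves \<open>\<theta> b\<close>, and \<open>b\<close>
    cancels.\<close>
  define K where "K = {z \<in> ?R. z * (1 - a) \<in> B}"
  have "ideal K (Z_sqrt_neg d)"
    unfolding ideal_Z_sqrt_neg_iff K_def
    using carrier_Z_sqrt_neg_closed one_zero_in_carrier B[unfolded ideal_Z_sqrt_neg_iff]
    by (auto simp: distrib_right mult.assoc)
  moreover have "{a, b} \<subseteq> K"
    using assms a1 by (auto simp: K_def B_def B_iff[unfolded B_def] mult.commute)
  ultimately have "Idl\<^bsub>Z_sqrt_neg d\<^esub> {a, b} \<subseteq> K" using Idl_Z_sqrt_neg_props(3)[OF ab] by blast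
  hence "\<theta> * b * (1 - a) \<in> B" "\<theta> * a \<in> ?R" using \<theta> by (auto simp: K_def)
  moreover have "\<theta> * a * b \<in> B" using \<open>\<theta> * a \<in> ?R\<close> B_iff by blast
  ultimately have "\<theta> * b * (1 - a) + \<theta> * a * b \<in> B" using ideal_add_closed[OF B] by blast
  hence "\<theta> * b \<in> B" by (simp add: algebra_simps)
  thus ?thesis using B_iff assms(3) by auto
qed

lemma half_not_in_carrier:
  assumes "d > 0"
  shows "(1 + csqrt (- of_int d)) / 2 \<notin> carrier (Z_sqrt_neg d)"
proof
  assume "(1 + csqrt (- of_int d)) / 2 \<in> carrier (Z_sqrt_neg d)"
  then obtain x y where "(1 + csqrt (- of_int d)) / 2 = quad d x y" by (rule carrier_Z_sqrt_negE)
  hence "quad d 1 1 = quad d (2 * x) (2 * y)" by (simp add: quad_def field_simps)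
  hence "1 = 2 * x" using quad_eq_iff[OF assms] by blast
  thus False by presburger
qed

lemma princ_Z_sqrt_neg:
  assumes d: "d \<in> {1, 2, 3, 7}"
  shows "princ (Z_sqrt_neg d)"
proof -
  have d0: "d > 0" using d by auto
  \<comment> \<open>One alternative of the definition suffices, as the other arises by exchanging
    \<open>a\<close> and \<open>b\<close>. The case \<open>b = 0\<close> is separate because the
    multiplier argument cancels \<open>b\<close>.\<close>
  have main: "principalideal (Idl\<^bsub>Z_sqrt_neg d\<^esub> {a, b}) (Z_sqrt_neg d)"
    if ab: "a \<in> carrier (Z_sqrt_neg d)" "b \<in> carrier (Z_sqrt_neg d)"
      and mem: "a * (1 - a) \<in> PIdl\<^bsub>Z_sqrt_neg d\<^esub> b" for a b
  proof -
    have sub: "{a, b} \<subseteq> carrier (Z_sqrt_neg d)" using ab by simp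
    note I = Idl_Z_sqrt_neg_props[OF sub]
    show ?thesis
    proof (cases "b = 0")
      case True
      interpret domain "Z_sqrt_neg d" by (rule domain_Z_sqrt_neg)
      have "ideal (PIdl\<^bsub>Z_sqrt_neg d\<^esub> a) (Z_sqrt_neg d)" by (rule cgenideal_ideal[OF ab(1)])
      moreover have "{a, b} \<subseteq> PIdl\<^bsub>Z_sqrt_neg d\<^esub> a"
        using cgenideal_self[OF ab(1)] calculation True by (simp add: ideal_Z_sqrt_neg_iff)
      ultimately have "Idl\<^bsub>Z_sqrt_neg d\<^esub> {a, b} = PIdl\<^bsub>Z_sqrt_neg d\<^esub> a"
        using I cgenideal_minimal[of "Idl\<^bsub>Z_sqrt_neg d\<^esub> {a, b}" a] by auto
      thus ?thesis unfolding principalideal_Z_sqrt_neg_iff using ab by blast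
    next
      case False
      show ?thesis
        using ideal_principal_or_stable[OF d I(1)] I(2) half_not_in_carrier[OF d0]
          multiplier_of_idempotent_pair[OF ab False mem] by auto
    qed
  qed
  show ?thesis
    unfolding princ_def
  proof (intro allI impI)
    fix a b assume "idempotent_pair (Z_sqrt_neg d) a b"
    thus "principalideal (Idl\<^bsub>Z_sqrt_neg d\<^esub> {a, b}) (Z_sqrt_neg d)"
      unfolding idempotent_pair_Z_sqrt_neg_iff using main[of a b] main[of b a]
      by (auto simp: insert_commute)
  qed
qed

text \<open>The stable alternative in \<open>ideal_principal_or_stable\<close> is confined to 3 and
  7.\<close>

lemma principal_domain_Z_sqrt_neg:
  assumes "d \<in> {1, 2}"
  shows "principal_domain (Z_sqrt_neg d)"
proof -
  interpret domain "Z_sqrt_neg d" by (rule domain_Z_sqrt_neg)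
  show ?thesis
  proof
    fix I assume "ideal I (Z_sqrt_neg d)"
    hence "principalideal I (Z_sqrt_neg d)" using ideal_principal_or_stable[of d I] assms by auto
    thus "\<exists>a\<in>carrier (Z_sqrt_neg d). I = PIdl\<^bsub>Z_sqrt_neg d\<^esub> a"
      by (simp add: principalideal_Z_sqrt_neg_iff)
  qed
qed

theorem theorem4p7:
  fixes d :: int
  assumes "d > 0" and "squarefree d"
  shows "(princ (Z_sqrt_neg d) \<longleftrightarrow> d \<in> {1, 2, 3, 7}) \<and>
         (d \<in> {1, 2} \<longrightarrow> principal_domain (Z_sqrt_neg d))"
  using assms not_princ_Z_sqrt_neg princ_Z_sqrt_neg principal_domain_Z_sqrt_neg by blast

end
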